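(* There are absolute constants $K > 0$ and $k > 0$ such that the following holds. Let $N, s \in \mathbb{N}$ with $s \le N$, and let $P$ be a set of $N$ points chosen independently and uniformly at random from $[0,1]^s$. Then the expected star discrepancy satisfies $E[D^*(P)] \ge K\sqrt{s/N}$, and $\Pr\big[D^*(P) < K\sqrt{s/N}\big] \le e^{-ks}$.
   Context: For $x \in [0,1]^s$ let $[0,x] := \prod_{i=1}^s [0,x_i]$ (an anchored box), and let $\mathcal{B} := \{[0,x] \mid x \in [0,1]^s\}$. For $P \subseteq [0,1]^s$ with $|P| = N$, the star discrepancy is $D^*(P) := \sup_{B \in \mathcal{B}} \big| \tfrac{1}{N}|P \cap B| - \mathrm{vol}(B) \big|$, where $\mathrm{vol}$ denotes Lebesgue measure. The random point set consists of $N$ points (a multiset if coincidences occur, which happens with probability zero). *)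

theory Defs
  imports "HOL-Probability.Probability"
begin

definition unit_cube :: "nat \<Rightarrow> (nat \<Rightarrow> real) set" where
  "unit_cube s = PiE {..<s} (\<lambda>_. {0..1})"

definition anchored_box :: "nat \<Rightarrow> (nat \<Rightarrow> real) \<Rightarrow> (nat \<Rightarrow> real) set" where
  "anchored_box s x = PiE {..<s} (\<lambda>i. {0..x i})"

definition vol :: "nat \<Rightarrow> (nat \<Rightarrow> real) set \<Rightarrow> real" where
  "vol s B = measure (PiM {..<s} (\<lambda>_. lborel)) B"

definition star_discrepancy :: "nat \<Rightarrow> nat \<Rightarrow> (nat \<Rightarrow> nat \<Rightarrow> real) \<Rightarrow> real" where
  "star_discrepancy s N p =
     (SUP x \<in> unit_cube s.
        \<bar>real (card {j \<in> {..<N}. p j \<in> anchored_box s x}) / real N - vol s (anchored_box s x)\<bar>)"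

definition uniform_cube :: "nat \<Rightarrow> (nat \<Rightarrow> real) measure" where
  "uniform_cube s = PiM {..<s} (\<lambda>_. uniform_measure lborel {0..1::real})"

definition random_points :: "nat \<Rightarrow> nat \<Rightarrow> (nat \<Rightarrow> nat \<Rightarrow> real) measure" where
  "random_points N s = PiM {..<N} (\<lambda>_. uniform_cube s)"

end

theory Submission
  imports Defs
begin

text \<open>Put \<^term>\<open>\<delta> = 1 / (2 * s)\<close> and build a box with many points greedily, one coordinate after the
other: cut coordinate \<^term>\<open>i\<close> at \<^term>\<open>1 - \<delta>\<close> if the slab above \<^term>\<open>1 - \<delta>\<close> contains at least
\<^term>\<open>g\<close> points fewer than expected among those still in the box, where \<^term>\<open>g\<close> is a constant times
\<^term>\<open>sqrt (N / s)\<close>; otherwise leave this coordinate at \<^term>\<open>1::real\<close>. The box keeps volume at least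
\<^term>\<open>1/2\<close>, hence at least half of the points, so the slab count always has standard
deviation of order \<^term>\<open>sqrt (N / s)\<close>, and each cut happens with conditional probability bounded below
by a constant. Outside an event of probability at most \<^term>\<open>exp (- k * s)\<close> there are of order \<^term>\<open>s\<close>
cuts, which add up to a surplus of order \<^term>\<open>sqrt (s * N)\<close> points. The bound on the
expectation then follows from Markov's inequality.\<close>

subsection \<open>Greedy cutting of coordinates\<close>

definition light :: "real \<Rightarrow> real \<Rightarrow> 'a set \<Rightarrow> 'a set \<Rightarrow> bool" where
  "light \<delta> g S C \<longleftrightarrow> real (card (S \<inter> C)) \<le> \<delta> * real (card S) - g"

text \<open>The geometry is abstracted away: \<open>U\<close> stands for the point indices and
  \<open>C i\<close> for those in the slab of coordinate \<open>i\<close>, so the greedy rule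
  becomes finite combinatorics that can be summed over all incidence patterns.\<close>

primrec survivors :: "real \<Rightarrow> real \<Rightarrow> 'a set \<Rightarrow> (nat \<Rightarrow> 'a set) \<Rightarrow> nat \<Rightarrow> 'a set" where
  "survivors \<delta> g U C 0 = U"
| "survivors \<delta> g U C (Suc m) =
     (if light \<delta> g (survivors \<delta> g U C m) (C m) then survivors \<delta> g U C m - C m
      else survivors \<delta> g U C m)"

definition cuts :: "real \<Rightarrow> real \<Rightarrow> 'a set \<Rightarrow> (nat \<Rightarrow> 'a set) \<Rightarrow> nat \<Rightarrow> nat set" where
  "cuts \<delta> g U C m = {i. i < m \<and> light \<delta> g (survivors \<delta> g U C i) (C i)}"

lemma cuts_0 [simp]: "cuts \<delta> g U C 0 = {}"
  by (simp add: cuts_def)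

lemma cuts_Suc:
  "cuts \<delta> g U C (Suc m) =
     (if light \<delta> g (survivors \<delta> g U C m) (C m) then insert m (cuts \<delta> g U C m)
      else cuts \<delta> g U C m)"
  by (auto simp: cuts_def less_Suc_eq)

lemma finite_cuts [simp]: "finite (cuts \<delta> g U C m)"
  by (simp add: cuts_def)

lemma cuts_subset: "cuts \<delta> g U C m \<subseteq> {..<m}"
  by (auto simp: cuts_def)

lemma card_cuts_Suc:
  "card (cuts \<delta> g U C (Suc m)) =
     card (cuts \<delta> g U C m) + (if light \<delta> g (survivors \<delta> g U C m) (C m) then 1 else 0)"
  using cuts_subset[of \<delta> g U C m] by (auto simp: cuts_Suc card_insert_if)

lemma survivors_subset: "survivors \<delta> g U C m \<subseteq> U"
  by (induction m) auto

lemma survivors_iff: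
  "survivors \<delta> g U C m = {j \<in> U. \<forall>i \<in> cuts \<delta> g U C m. j \<notin> C i}"
  by (induction m) (auto simp: cuts_Suc)

text \<open>Stage \<open>m\<close> looks only at columns before \<open>m\<close>. Column
  \<open>m\<close> can therefore be averaged later with the earlier decisions held fixed.\<close>

lemma survivors_cong:
  "(\<And>i. i < m \<Longrightarrow> C i = C' i) \<Longrightarrow> survivors \<delta> g U C m = survivors \<delta> g U C' m"
  by (induction m) auto

lemma cuts_cong:
  assumes "\<And>i. i < m \<Longrightarrow> C i = C' i"
  shows "cuts \<delta> g U C m = cuts \<delta> g U C' m"
  unfolding cuts_def
proof (intro Collect_cong conj_cong refl)
  fix i assume "i < m"
  then show "light \<delta> g (survivors \<delta> g U C i) (C i) = light \<delta> g (survivors \<delta> g U C' i) (C' i)"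
    using assms survivors_cong[of i C C' \<delta> g U] by simp
qed

text \<open>The first summand is the expected number of points in the box. Each cut retains at least
  a fraction \<open>1 - \<delta>\<close> of the points and gains a surplus \<open>g\<close>; later
  cuts shrink this surplus by at most \<open>(1 - \<delta>) ^ m\<close> in total.\<close>

lemma card_survivors_ge:
  assumes fin: "finite U" and \<delta>: "0 \<le> \<delta>" "\<delta> \<le> 1" and g: "0 \<le> g"
  shows "real (card U) * (1 - \<delta>) ^ card (cuts \<delta> g U C m)
           + g * (1 - \<delta>) ^ m * real (card (cuts \<delta> g U C m))
         \<le> real (card (survivors \<delta> g U C m))"
proof (induction m)
  case 0
  then show ?case by simp
next
  case (Suc m)
  define S c where "S = survivors \<delta> g U C m" and "c = card (cuts \<delta> g U C m)"
  have finS: "finite S"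
    unfolding S_def using survivors_subset fin by (rule finite_subset)
  have IH: "real (card U) * (1 - \<delta>) ^ c + g * (1 - \<delta>) ^ m * real c \<le> real (card S)"
    using Suc unfolding S_def c_def .
  have pw: "(1 - \<delta>) ^ Suc m \<le> (1 - \<delta>) ^ m" "(1 - \<delta>) ^ Suc m \<le> 1"
    using power_decreasing[of m "Suc m" "1 - \<delta>"] power_le_one[of "1 - \<delta>" "Suc m"] \<delta>
    by auto
  show ?case
  proof (cases "light \<delta> g S (C m)")
    case True
    have "real (card (S - C m)) = real (card S) - real (card (S \<inter> C m))"
      using finS by (simp add: card_Diff_subset_Int of_nat_diff card_mono)
    then have le: "(1 - \<delta>) * real (card S) + g \<le> real (card (S - C m))"
      using True by (simp add: light_def algebra_simps)
    have "(1 - \<delta>) * (real (card U) * (1 - \<delta>) ^ c + g * (1 - \<delta>) ^ m * real c)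
        \<le> (1 - \<delta>) * real (card S)"
      using IH \<delta> by (intro mult_left_mono) auto
    \<comment> \<open>The new surplus is a full \<open>g\<close>, but it is credited only at the
      discounted rate, which makes all cuts count alike.\<close>
    moreover have "g * (1 - \<delta>) ^ Suc m \<le> g * 1"
      using pw g by (intro mult_left_mono) auto
    ultimately show ?thesis
      using True le by (simp add: card_cuts_Suc S_def[symmetric] c_def[symmetric] algebra_simps)
  next
    case False
    have "g * (1 - \<delta>) ^ Suc m * real c \<le> g * (1 - \<delta>) ^ m * real c"
      using pw g by (intro mult_right_mono mult_left_mono) auto
    then show ?thesis
      using False IH by (simp add: card_cuts_Suc S_def[symmetric] c_def[symmetric])
  qed
qed

subsection \<open>Anticoncentration for random subsets\<close>

text \<open>The law of a random subset of \<open>U\<close> that contains each element independently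
  with probability \<open>\<delta>\<close>; \<open>subset_mean\<close> is its expectation, written
  as a finite sum.\<close>

definition subset_weight :: "real \<Rightarrow> 'a set \<Rightarrow> 'a set \<Rightarrow> real" where
  "subset_weight \<delta> U C = \<delta> ^ card C * (1 - \<delta>) ^ card (U - C)"

definition subset_mean :: "real \<Rightarrow> 'a set \<Rightarrow> ('a set \<Rightarrow> real) \<Rightarrow> real" where
  "subset_mean \<delta> U f = (\<Sum>C\<in>Pow U. subset_weight \<delta> U C * f C)"

lemma subset_weight_nonneg: "0 \<le> \<delta> \<Longrightarrow> \<delta> \<le> 1 \<Longrightarrow> 0 \<le> subset_weight \<delta> U C"
  by (simp add: subset_weight_def)

lemma subset_weight_prod:
  assumes "finite U" "C \<subseteq> U"
  shows "subset_weight \<delta> U C = (\<Prod>j\<in>U. if j \<in> C then \<delta> else 1 - \<delta>)"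
proof -
  have "U \<inter> {j. j \<in> C} = C" "U \<inter> - {j. j \<in> C} = U - C"
    using assms by auto
  then show ?thesis
    using assms by (simp add: prod.If_cases subset_weight_def)
qed

lemma subset_mean_add: "subset_mean \<delta> U (\<lambda>C. f C + h C) = subset_mean \<delta> U f + subset_mean \<delta> U h"
  by (simp add: subset_mean_def algebra_simps sum.distrib)

lemma subset_mean_cmult: "subset_mean \<delta> U (\<lambda>C. c * f C) = c * subset_mean \<delta> U f"
  by (simp add: subset_mean_def sum_distrib_left mult.left_commute)

lemma subset_mean_mono:
  assumes "0 \<le> \<delta>" "\<delta> \<le> 1" "\<And>C. C \<subseteq> U \<Longrightarrow> f C \<le> h C"
  shows "subset_mean \<delta> U f \<le> subset_mean \<delta> U h"
  unfolding subset_mean_def using assms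
  by (intro sum_mono mult_left_mono subset_weight_nonneg) auto

lemma subset_mean_cong:
  "(\<And>C. C \<subseteq> U \<Longrightarrow> f C = h C) \<Longrightarrow> subset_mean \<delta> U f = subset_mean \<delta> U h"
  by (simp add: subset_mean_def)

text \<open>Conditioning on whether \<open>a\<close> is chosen; this recursion drives the inductions
  over \<open>U\<close>.\<close>

lemma subset_mean_insert:
  assumes "finite U" "a \<notin> U"
  shows "subset_mean \<delta> (insert a U) f
    = (1 - \<delta>) * subset_mean \<delta> U f + \<delta> * subset_mean \<delta> U (\<lambda>C. f (insert a C))"
proof -
  have disj: "Pow U \<inter> insert a ` Pow U = {}"
    using assms by auto
  have inj: "inj_on (insert a) (Pow U)"
    using assms by (auto simp: inj_on_def)
  have w: "subset_weight \<delta> (insert a U) C = (1 - \<delta>) * subset_weight \<delta> U C"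
    "subset_weight \<delta> (insert a U) (insert a C) = \<delta> * subset_weight \<delta> U C" if "C \<subseteq> U" for C
  proof -
    have "a \<notin> C" "finite C" "insert a U - C = insert a (U - C)" "insert a U - insert a C = U - C"
      using that assms by (auto intro: finite_subset)
    then show "subset_weight \<delta> (insert a U) C = (1 - \<delta>) * subset_weight \<delta> U C"
      "subset_weight \<delta> (insert a U) (insert a C) = \<delta> * subset_weight \<delta> U C"
      using assms by (auto simp: subset_weight_def)
  qed
  have "subset_mean \<delta> (insert a U) f =
      (\<Sum>C\<in>Pow U. subset_weight \<delta> (insert a U) C * f C)
      + (\<Sum>C\<in>Pow U. subset_weight \<delta> (insert a U) (insert a C) * f (insert a C))"
    unfolding subset_mean_def Pow_insert using assms
    by (subst sum.union_disjoint[OF _ _ disj]) (auto simp: sum.reindex[OF inj])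
  then show ?thesis
    by (simp add: subset_mean_def sum_distrib_left w mult.assoc)
qed

lemma subset_mean_const: "finite U \<Longrightarrow> subset_mean \<delta> U (\<lambda>_. c) = c"
  by (induction U rule: finite_induct)
     (auto simp: subset_mean_insert algebra_simps, simp add: subset_mean_def subset_weight_def)

text \<open>\<open>Z\<close> is a sum of independent centred Bernoulli variables of variance
  \<open>v\<close>. Adding an element of \<open>S\<close> adds an independent increment,
  \<open>- \<delta>\<close> or \<open>1 - \<delta>\<close>, and elements outside \<open>S\<close>
  change nothing.\<close>

lemma subset_mean_moments:
  fixes S U :: "'a set" and \<delta> :: real
  assumes "finite U" "0 \<le> \<delta>" "\<delta> \<le> 1"
  defines "v \<equiv> \<delta> * (1 - \<delta>)"
  defines "Z \<equiv> \<lambda>U C. real (card (S \<inter> C)) - \<delta> * real (card (S \<inter> U))"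
  shows "subset_mean \<delta> U (Z U) = 0
    \<and> subset_mean \<delta> U (\<lambda>C. Z U C ^ 2) = v * real (card (S \<inter> U))
    \<and> subset_mean \<delta> U (\<lambda>C. Z U C ^ 4)
        \<le> 3 * (v * real (card (S \<inter> U)))\<^sup>2 + v * real (card (S \<inter> U))"
  using assms(1)
proof (induction U rule: finite_induct)
  case empty
  then show ?case by (simp add: subset_mean_def Z_def)
next
  case (insert a U)
  show ?case
  proof (cases "a \<in> S")
    case False
    have "S \<inter> insert a C = S \<inter> C" for C
      using False by auto
    then have "Z (insert a U) C = Z U C" "Z (insert a U) (insert a C) = Z U C" for C
      by (auto simp: Z_def)
    then show ?thesis
      using insert False by (simp add: subset_mean_insert \<open>\<And>C. S \<inter> insert a C = S \<inter> C\<close> algebra_simps)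
  next
    case True
    define n where "n = real (card (S \<inter> U))"
    have n: "real (card (S \<inter> insert a U)) = n + 1"
      using True insert by (simp add: n_def)
    have Z0: "Z (insert a U) C = Z U C - \<delta>" for C
      using n by (simp add: Z_def n_def algebra_simps)
    have Z1: "Z (insert a U) (insert a C) = Z U C + (1 - \<delta>)" if "C \<subseteq> U" for C
    proof -
      have "a \<notin> C" "finite C"
        using that insert by (auto intro: finite_subset)
      then have "card (S \<inter> insert a C) = Suc (card (S \<inter> C))"
        using True by simp
      then show ?thesis
        using n by (simp add: Z_def n_def algebra_simps)
    qed
    define m1 m2 m3 m4 where
      "m1 = subset_mean \<delta> U (Z U)" and "m2 = subset_mean \<delta> U (\<lambda>C. Z U C ^ 2)"
      and "m3 = subset_mean \<delta> U (\<lambda>C. Z U C ^ 3)" and "m4 = subset_mean \<delta> U (\<lambda>C. Z U C ^ 4)"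
    have IH: "m1 = 0" "m2 = v * n" "m4 \<le> 3 * (v * n)\<^sup>2 + v * n"
      using insert.IH by (auto simp: m1_def m2_def m4_def n_def)
    note lin = subset_mean_add subset_mean_cmult subset_mean_const[OF insert(1)]
    have s1: "subset_mean \<delta> U (\<lambda>C. Z U C + c) = m1 + c" for c
      by (simp add: lin m1_def)
    have s2: "subset_mean \<delta> U (\<lambda>C. (Z U C + c) ^ 2) = m2 + 2 * c * m1 + c ^ 2" for c
    proof -
      have "subset_mean \<delta> U (\<lambda>C. (Z U C + c) ^ 2)
          = subset_mean \<delta> U (\<lambda>C. Z U C ^ 2 + ((2 * c) * Z U C + c ^ 2))"
        by (intro subset_mean_cong) (simp add: power2_eq_square algebra_simps)
      then show ?thesis
        by (simp only: lin m1_def m2_def)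
    qed
    have s4: "subset_mean \<delta> U (\<lambda>C. (Z U C + c) ^ 4)
        = m4 + 4 * c * m3 + 6 * c ^ 2 * m2 + 4 * c ^ 3 * m1 + c ^ 4" for c
    proof -
      have "subset_mean \<delta> U (\<lambda>C. (Z U C + c) ^ 4)
          = subset_mean \<delta> U (\<lambda>C. Z U C ^ 4 + ((4 * c) * Z U C ^ 3 + ((6 * c ^ 2) * Z U C ^ 2
              + ((4 * c ^ 3) * Z U C + c ^ 4))))"
        by (intro subset_mean_cong) algebra
      then show ?thesis
        by (simp only: lin m1_def m2_def m3_def m4_def)
    qed
    have step: "subset_mean \<delta> (insert a U) (\<lambda>C. Z (insert a U) C ^ k)
        = (1 - \<delta>) * subset_mean \<delta> U (\<lambda>C. (Z U C + (- \<delta>)) ^ k)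
          + \<delta> * subset_mean \<delta> U (\<lambda>C. (Z U C + (1 - \<delta>)) ^ k)" for k
    proof -
      have "subset_mean \<delta> U (\<lambda>C. Z (insert a U) (insert a C) ^ k)
          = subset_mean \<delta> U (\<lambda>C. (Z U C + (1 - \<delta>)) ^ k)"
        by (intro subset_mean_cong) (simp only: Z1)
      then show ?thesis
        unfolding subset_mean_insert[OF insert(1,2)] by (simp add: Z0)
    qed
    have 1: "subset_mean \<delta> (insert a U) (Z (insert a U)) = 0"
      using step[of 1] unfolding power_one_right s1 IH by (simp add: algebra_simps)
    have 2: "subset_mean \<delta> (insert a U) (\<lambda>C. Z (insert a U) C ^ 2) = v * (n + 1)"
      unfolding step s2 using IH unfolding v_def by algebra
    \<comment> \<open>The increment has mean 0, so the unknown third moment \<open>m3\<close>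
      cancels. Its second and fourth moments are \<open>v\<close> and
      \<open>v * (1 - 3 * v)\<close>.\<close>
    have "subset_mean \<delta> (insert a U) (\<lambda>C. Z (insert a U) C ^ 4)
        = m4 + 6 * v * m2 + v * (1 - 3 * v)"
      unfolding step s4 using IH unfolding v_def by algebra
    also have "\<dots> \<le> 3 * (v * n)\<^sup>2 + v * n + 6 * v * (v * n) + v * (1 - 3 * v)"
      using IH by simp
    also have "\<dots> = 3 * (v * (n + 1))\<^sup>2 + v * (n + 1) - 6 * v\<^sup>2"
      by algebra
    finally have 4: "subset_mean \<delta> (insert a U) (\<lambda>C. Z (insert a U) C ^ 4)
        \<le> 3 * (v * (n + 1))\<^sup>2 + v * (n + 1)"
      using zero_le_power2[of v] by linarith
    show ?thesis
      unfolding n using 1 2 4 by simp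
  qed
qed

text \<open>A polynomial minorant of the indicator of \<^term>\<open>z \<le> - 1/10\<close>: its expectation involves only the moments
of order 1, 2 and 4, so it turns moment bounds into a lower bound for a one-sided tail.\<close>

lemma quartic_test:
  fixes z :: real
  shows "- z + z\<^sup>2 / 5 - z ^ 4 / 125 \<le> 6 * of_bool (z \<le> - 1/10) + 51/500"
proof (cases "z \<le> - 1/10")
  case True
  \<comment> \<open>A sum-of-squares certificate with positive remainder 17/40.\<close>
  have "6 - (- z + z\<^sup>2 / 5 - z ^ 4 / 125) = (z\<^sup>2 - 35/2)\<^sup>2 / 125 + 2/25 * (z + 25/4)\<^sup>2 + (6 - 49/20 - 25/8)"
    by (simp add: power2_eq_square power4_eq_xxxx field_simps)
  also have "\<dots> \<ge> 0"
    by simp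
  finally show ?thesis
    using True by simp
next
  case False
  show ?thesis
  proof (cases "z \<le> 0")
    case True
    \<comment> \<open>Here the polynomial is at most 1/10 + (1/5) * (1/100) = 51/500, the additive
      constant of the claim.\<close>
    have "z\<^sup>2 \<le> (1/10)\<^sup>2"
      using True False by (intro power2_le_iff_abs_le[THEN iffD2]) auto
    then have "z\<^sup>2 \<le> 1/100"
      by (simp add: power2_eq_square)
    moreover have "0 \<le> z ^ 4" by simp
    moreover have "- z \<le> 1/10" "of_bool (z \<le> - 1/10) = (0::real)"
      using False by auto
    ultimately show ?thesis
      by linarith
  next
    case pos: False
    \<comment> \<open>Up to 5 the linear term outweighs the quadratic one; beyond 5 the quartic term
      does.\<close>
    have "- z + z\<^sup>2 / 5 - z ^ 4 / 125 \<le> 0"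
    proof (cases "z \<le> 5")
      case True
      have "z\<^sup>2 \<le> 5 * z"
        unfolding power2_eq_square using True pos by (intro mult_right_mono) auto
      moreover have "0 \<le> z ^ 4" by simp
      ultimately show ?thesis by linarith
    next
      case False
      have "5\<^sup>2 \<le> z\<^sup>2"
        using False by (intro power_mono) auto
      then have "5\<^sup>2 * z\<^sup>2 \<le> z\<^sup>2 * z\<^sup>2"
        by (intro mult_right_mono) auto
      then have "25 * z\<^sup>2 \<le> z ^ 4"
        by (simp add: power2_eq_square power4_eq_xxxx)
      then show ?thesis
        using pos by linarith
    qed
    then show ?thesis
      using False by simp
  qed
qed

text \<open>Averaging \<open>quartic_test\<close> over the standardised count, with moments 0, 1 and
  at most 11, gives (1/5 - 11/125 - 51/500) / 6 = 1/600.\<close>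

lemma subset_mean_light_ge:
  fixes S U :: "'a set" and \<delta> g :: real
  assumes fin: "finite U" and SU: "S \<subseteq> U" and \<delta>: "0 \<le> \<delta>" "\<delta> \<le> 1"
    and var: "1/8 \<le> \<delta> * (1 - \<delta>) * real (card S)"
    and g: "g \<le> sqrt (\<delta> * (1 - \<delta>) * real (card S)) / 10"
  shows "1/600 \<le> subset_mean \<delta> U (\<lambda>C. of_bool (light \<delta> g S C))"
proof -
  define V where "V = \<delta> * (1 - \<delta>) * real (card S)"
  define \<sigma> where "\<sigma> = sqrt V"
  define Z where "Z = (\<lambda>C. real (card (S \<inter> C)) - \<delta> * real (card S))"
  have g': "g \<le> \<sigma> / 10" using g by (simp add: \<sigma>_def V_def)
  have V: "1/8 \<le> V" using var by (simp add: V_def)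
  then have \<sigma>: "\<sigma> > 0" "\<sigma>\<^sup>2 = V" "\<sigma> ^ 4 = V\<^sup>2"
    by (auto simp: \<sigma>_def power4_eq_xxxx power2_eq_square)
  have mom: "subset_mean \<delta> U Z = 0" "subset_mean \<delta> U (\<lambda>C. Z C ^ 2) = V"
    "subset_mean \<delta> U (\<lambda>C. Z C ^ 4) \<le> 3 * V\<^sup>2 + V"
    using subset_mean_moments[OF fin \<delta>, of S] SU by (simp_all add: Z_def V_def Int_absorb2)
  have le: "- 51/3000 + ((- 1/6 / \<sigma>) * Z C + ((1/30 / \<sigma>\<^sup>2) * Z C ^ 2 + (- 1/750 / \<sigma> ^ 4) * Z C ^ 4))
      \<le> of_bool (light \<delta> g S C)" for C
  proof -
    have "Z C / \<sigma> \<le> - 1/10 \<Longrightarrow> light \<delta> g S C"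
      using \<sigma>(1) g' by (simp add: Z_def light_def field_simps)
    then have le: "of_bool (Z C / \<sigma> \<le> - 1/10) \<le> (of_bool (light \<delta> g S C) :: real)"
      by simp
    \<comment> \<open>This is \<open>quartic_test\<close> divided by 6, with the nonlinear terms
      replaced by variables so that linear arithmetic suffices.\<close>
    have *: "- 51/3000 + (a + (b + d)) \<le> Y"
      if "a = - u / 6" "b = w / 30" "d = - x / 750" "- u + w / 5 - x / 125 \<le> 6 * X + 51/500" "X \<le> Y"
      for a b d u w x X Y :: real
      using that by linarith
    show ?thesis
    proof (rule *[OF _ _ _ quartic_test le])
      show "(- 1/6 / \<sigma>) * Z C = - (Z C / \<sigma>) / 6"
        "(1/30 / \<sigma>\<^sup>2) * Z C ^ 2 = (Z C / \<sigma>)\<^sup>2 / 30"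
        "(- 1/750 / \<sigma> ^ 4) * Z C ^ 4 = - ((Z C / \<sigma>) ^ 4) / 750"
        by (simp_all add: power_divide)
    qed
  qed
  \<comment> \<open>The standardised fourth moment is at most 3 + 1/V, and
    \<open>1/8 \<le> V\<close> turns this into 11.\<close>
  have "subset_mean \<delta> U (\<lambda>C. Z C ^ 4) / \<sigma> ^ 4 \<le> (3 * V\<^sup>2 + V) / \<sigma> ^ 4"
    using mom(3) by (intro divide_right_mono) auto
  also have "\<dots> = 3 + 1 / V"
    using \<sigma> V by (simp add: power2_eq_square field_simps)
  also have "\<dots> \<le> 11"
    using V by (simp add: field_simps)
  finally have m4: "subset_mean \<delta> U (\<lambda>C. Z C ^ 4) / \<sigma> ^ 4 \<le> 11" .
  have "1/600 \<le> - 51/3000 + ((- 1/6 / \<sigma>) * subset_mean \<delta> U Z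
      + ((1/30 / \<sigma>\<^sup>2) * subset_mean \<delta> U (\<lambda>C. Z C ^ 2)
      + (- 1/750 / \<sigma> ^ 4) * subset_mean \<delta> U (\<lambda>C. Z C ^ 4)))"
    using m4 V by (simp add: mom \<sigma>(2))
  also have "\<dots> = subset_mean \<delta> U (\<lambda>C. - 51/3000 + ((- 1/6 / \<sigma>) * Z C
      + ((1/30 / \<sigma>\<^sup>2) * Z C ^ 2 + (- 1/750 / \<sigma> ^ 4) * Z C ^ 4)))"
    by (simp only: subset_mean_add subset_mean_cmult subset_mean_const[OF fin])
  also have "\<dots> \<le> subset_mean \<delta> U (\<lambda>C. of_bool (light \<delta> g S C))"
    using le \<delta> by (intro subset_mean_mono) auto
  finally show ?thesis .
qed

subsection \<open>The number of cuts\<close>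

lemma sum_PiE_lessThan_Suc:
  "(\<Sum>f\<in>PiE {..<Suc m} B. h f) = (\<Sum>f\<in>PiE {..<m} B. \<Sum>y\<in>B m. h (f(m := y)))"
proof -
  have "(\<Sum>f\<in>PiE {..<Suc m} B. h f) = (\<Sum>(y, f)\<in>B m \<times> PiE {..<m} B. h (f(m := y)))"
    unfolding lessThan_Suc PiE_insert_eq
    by (subst sum.reindex[OF inj_combinator]) (auto simp: case_prod_unfold)
  also have "\<dots> = (\<Sum>f\<in>PiE {..<m} B. \<Sum>y\<in>B m. h (f(m := y)))"
    by (simp add: sum.cartesian_product[symmetric] sum.swap[of _ "B m"])
  finally show ?thesis .
qed

lemma sum_column_weights:
  fixes m :: nat
  assumes "finite U"
  shows "(\<Sum>C\<in>PiE {..<m} (\<lambda>_. Pow U). \<Prod>i<m. subset_weight \<delta> U (C i)) = 1"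
proof (induction m)
  case 0
  then show ?case by simp
next
  case (Suc m)
  have "(\<Sum>y\<in>Pow U. subset_weight \<delta> U y) = 1"
    using subset_mean_const[OF assms, of \<delta> 1] by (simp add: subset_mean_def)
  with Suc show ?case
    by (simp add: sum_PiE_lessThan_Suc sum_distrib_left[symmetric])
qed

text \<open>An exponential moment of the number of cuts: given the earlier columns, a cut occurs
  with probability at least \<open>p\<close>, so each column contributes a factor of at most
  \<open>1 - p / 2\<close>.\<close>

lemma sum_half_power_cuts_le:
  assumes fin: "finite U" and \<delta>: "0 \<le> \<delta>" "\<delta> \<le> 1" and g: "0 \<le> g" and p: "p \<le> 1"
    and light: "\<And>S. S \<subseteq> U \<Longrightarrow> real (card U) * (1 - \<delta>) ^ s \<le> real (card S) \<Longrightarrow>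
        p \<le> subset_mean \<delta> U (\<lambda>C. of_bool (light \<delta> g S C))"
    and "m \<le> s"
  shows "(\<Sum>C\<in>PiE {..<m} (\<lambda>_. Pow U). (\<Prod>i<m. subset_weight \<delta> U (C i))
            * (1/2) ^ card (cuts \<delta> g U C m)) \<le> (1 - p / 2) ^ m"
  using \<open>m \<le> s\<close>
proof (induction m)
  case 0
  then show ?case by simp
next
  case (Suc m)
  define W where "W = (\<lambda>C. (\<Prod>i<m. subset_weight \<delta> U (C i)) * (1/2) ^ card (cuts \<delta> g U C m))"
  have W: "0 \<le> W C" for C
    unfolding W_def using \<delta> by (intro mult_nonneg_nonneg prod_nonneg subset_weight_nonneg) auto
  have inner: "(\<Sum>D\<in>Pow U. (\<Prod>i<Suc m. subset_weight \<delta> U ((C(m := D)) i))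
      * (1/2) ^ card (cuts \<delta> g U (C(m := D)) (Suc m))) \<le> W C * (1 - p / 2)" for C
  proof -
    define S where "S = survivors \<delta> g U C m"
    \<comment> \<open>At most \<open>s\<close> cuts have been made, so whatever the earlier columns
      are, enough points survive for the hypothesis \<open>light\<close> to apply.\<close>
    have "real (card U) * (1 - \<delta>) ^ s \<le> real (card U) * (1 - \<delta>) ^ card (cuts \<delta> g U C m)"
      using \<delta> Suc.prems card_mono[OF finite_lessThan cuts_subset, of \<delta> g U C m]
      by (intro mult_left_mono power_decreasing) auto
    also have "\<dots> \<le> \<dots> + g * (1 - \<delta>) ^ m * real (card (cuts \<delta> g U C m))"
      using g \<delta> by simp
    also have "\<dots> \<le> real (card S)"
      unfolding S_def using fin \<delta> g by (rule card_survivors_ge)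
    finally have p_le: "p \<le> subset_mean \<delta> U (\<lambda>D. of_bool (light \<delta> g S D))"
      using survivors_subset[of \<delta> g U C m] by (intro light) (auto simp: S_def)
    have "survivors \<delta> g U (C(m := D)) m = S" "cuts \<delta> g U (C(m := D)) m = cuts \<delta> g U C m" for D
      unfolding S_def by ((rule survivors_cong cuts_cong, simp)+)
    \<comment> \<open>For an indicator X, (1/2)^X = 1 - X/2, which is linear in the event of a
      cut.\<close>
    then have "(\<Sum>D\<in>Pow U. (\<Prod>i<Suc m. subset_weight \<delta> U ((C(m := D)) i))
        * (1/2) ^ card (cuts \<delta> g U (C(m := D)) (Suc m)))
        = W C * subset_mean \<delta> U (\<lambda>D. 1 + (- 1/2) * of_bool (light \<delta> g S D))"
      unfolding subset_mean_def sum_distrib_left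
      by (intro sum.cong) (auto simp: card_cuts_Suc W_def)
    also have "\<dots> = W C * (1 - subset_mean \<delta> U (\<lambda>D. of_bool (light \<delta> g S D)) / 2)"
      by (simp only: subset_mean_add subset_mean_cmult subset_mean_const[OF fin]) simp
    also have "\<dots> \<le> W C * (1 - p / 2)"
      using p_le W by (intro mult_left_mono) auto
    finally show ?thesis .
  qed
  have "(\<Sum>C\<in>PiE {..<Suc m} (\<lambda>_. Pow U). (\<Prod>i<Suc m. subset_weight \<delta> U (C i))
            * (1/2) ^ card (cuts \<delta> g U C (Suc m)))
      \<le> (\<Sum>C\<in>PiE {..<m} (\<lambda>_. Pow U). W C * (1 - p / 2))"
    unfolding sum_PiE_lessThan_Suc by (intro sum_mono inner)
  also have "\<dots> = (\<Sum>C\<in>PiE {..<m} (\<lambda>_. Pow U). W C) * (1 - p / 2)"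
    by (simp add: sum_distrib_right)
  also have "\<dots> \<le> (1 - p / 2) ^ m * (1 - p / 2)"
    using Suc p unfolding W_def by (intro mult_right_mono) auto
  finally show ?case by (simp only: power_Suc2)
qed

text \<open>A Chernoff bound: on the event of few cuts, 1 is at most exp(p s / 4) times
  \<open>(1/2)\<close> to the number of cuts, and the exponential moment is at most exp(- p s /
  2).\<close>

lemma few_cuts_weight_le:
  assumes fin: "finite U" and \<delta>: "0 \<le> \<delta>" "\<delta> \<le> 1" and g: "0 \<le> g" and p: "p \<le> 1"
    and light: "\<And>S. S \<subseteq> U \<Longrightarrow> real (card U) * (1 - \<delta>) ^ s \<le> real (card S) \<Longrightarrow>
        p \<le> subset_mean \<delta> U (\<lambda>C. of_bool (light \<delta> g S C))"
  shows "(\<Sum>C\<in>{C \<in> PiE {..<s} (\<lambda>_. Pow U). real (card (cuts \<delta> g U C s)) < p / 4 * real s}.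
            \<Prod>i<s. subset_weight \<delta> U (C i)) \<le> exp (- (p / 4) * real s)"
proof -
  define W where "W = (\<lambda>C. \<Prod>i<s. subset_weight \<delta> U (C i))"
  define c where "c = (\<lambda>C. card (cuts \<delta> g U C s))"
  define A where "A = PiE {..<s} (\<lambda>_. Pow U)"
  have finA: "finite A"
    unfolding A_def using fin by (intro finite_PiE) auto
  have W: "0 \<le> W C" for C
    unfolding W_def using \<delta> by (intro prod_nonneg subset_weight_nonneg) auto
  have half: "1 \<le> exp (p / 4 * real s) * (1/2) ^ n" if "real n < p / 4 * real s" for n
  proof -
    \<comment> \<open>The crude estimate of 2 by e keeps logarithms out of the constants.\<close>
    have "(2::real) ^ n \<le> exp 1 ^ n"
      using exp_ge_add_one_self[of 1] by (intro power_mono) auto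
    also have "\<dots> = exp (real n)"
      by (simp add: exp_of_nat_mult[symmetric])
    also have "\<dots> \<le> exp (p / 4 * real s)"
      using that by simp
    finally show ?thesis
      by (simp add: power_one_over field_simps)
  qed
  have "(\<Sum>C\<in>{C \<in> A. real (c C) < p / 4 * real s}. W C)
      \<le> (\<Sum>C\<in>{C \<in> A. real (c C) < p / 4 * real s}. exp (p / 4 * real s) * (W C * (1/2) ^ c C))"
  proof (intro sum_mono)
    fix C assume "C \<in> {C \<in> A. real (c C) < p / 4 * real s}"
    then have "W C * 1 \<le> W C * (exp (p / 4 * real s) * (1/2) ^ c C)"
      using half[of "c C"] W by (intro mult_left_mono) auto
    then show "W C \<le> exp (p / 4 * real s) * (W C * (1/2) ^ c C)"
      by (simp add: mult_ac)
  qed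
  also have "\<dots> \<le> (\<Sum>C\<in>A. exp (p / 4 * real s) * (W C * (1/2) ^ c C))"
    using finA W by (intro sum_mono2) auto
  also have "\<dots> \<le> exp (p / 4 * real s) * (1 - p / 2) ^ s"
    unfolding sum_distrib_left[symmetric] W_def c_def A_def
    using sum_half_power_cuts_le[OF assms order_refl] by (intro mult_left_mono) auto
  also have "\<dots> \<le> exp (p / 4 * real s) * exp (- (p / 2)) ^ s"
    using exp_ge_add_one_self[of "- (p / 2)"] p by (intro mult_left_mono power_mono) auto
  also have "\<dots> = exp (- (p / 4) * real s)"
    by (simp add: exp_of_nat_mult[symmetric] exp_add[symmetric] algebra_simps)
  finally show ?thesis
    unfolding W_def c_def A_def .
qed

subsection \<open>Measurability of the star discrepancy\<close>

lemma prob_space_uniform_cube: "prob_space (uniform_cube s)"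
  unfolding uniform_cube_def by (intro prob_space_PiM prob_space_uniform_measure) auto

lemma prob_space_random_points: "prob_space (random_points N s)"
  unfolding random_points_def by (intro prob_space_PiM prob_space_uniform_cube)

lemma measure_PiM_PiE:
  assumes "\<And>i. prob_space (M i)" "finite I" "\<And>i. i \<in> I \<Longrightarrow> A i \<in> sets (M i)"
  shows "measure (PiM I M) (PiE I A) = (\<Prod>i\<in>I. measure (M i) (A i))"
proof -
  interpret prob_space "M i" for i by fact
  interpret finite_product_prob_space M I
    by standard (use assms(2) in auto)
  show ?thesis
    using assms(3) by (rule finite_measure_PiM_emb)
qed

lemma sets_uniform_cube_PiE:
  assumes "\<And>i. i < s \<Longrightarrow> A i \<in> sets borel"
  shows "PiE {..<s} A \<in> sets (uniform_cube s)"
  unfolding uniform_cube_def using assms by (intro sets_PiM_I_finite) auto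

lemma anchored_box_sets: "anchored_box s x \<in> sets (uniform_cube s)"
  unfolding anchored_box_def by (intro sets_uniform_cube_PiE) auto

lemma vol_anchored_box:
  assumes "x \<in> unit_cube s"
  shows "vol s (anchored_box s x) = (\<Prod>i<s. x i)"
proof -
  interpret product_sigma_finite "\<lambda>_. lborel :: real measure"
    by standard
  have x: "0 \<le> x i" if "i < s" for i
    using assms that by (auto simp: unit_cube_def PiE_iff)
  have "emeasure (PiM {..<s} (\<lambda>_. lborel)) (anchored_box s x) = (\<Prod>i<s. ennreal (x i))"
    unfolding anchored_box_def using x by (subst emeasure_PiM) (auto intro!: prod.cong)
  also have "\<dots> = ennreal (\<Prod>i<s. x i)"
    using x by (intro prod_ennreal) auto
  finally have "emeasure (PiM {..<s} (\<lambda>_. lborel)) (anchored_box s x) = ennreal (\<Prod>i<s. x i)" .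
  moreover have "0 \<le> (\<Prod>i<s. x i)"
    using x by (intro prod_nonneg) auto
  ultimately show ?thesis
    by (simp add: vol_def measure_def)
qed

text \<open>On \<open>unit_cube s\<close> this is the term under the supremum; the product form of
  the volume makes its continuity in the corner visible.\<close>

definition local_discrepancy ::
    "nat \<Rightarrow> nat \<Rightarrow> (nat \<Rightarrow> nat \<Rightarrow> real) \<Rightarrow> (nat \<Rightarrow> real) \<Rightarrow> real" where
  "local_discrepancy s N p x =
     \<bar>real (card {j \<in> {..<N}. p j \<in> anchored_box s x}) / real N - (\<Prod>i<s. x i)\<bar>"

lemma star_discrepancy_eq:
  "star_discrepancy s N p = (SUP x \<in> unit_cube s. local_discrepancy s N p x)"
  unfolding star_discrepancy_def local_discrepancy_def
  by (intro SUP_cong refl) (simp add: vol_anchored_box)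

lemma local_discrepancy_le_1:
  assumes "x \<in> unit_cube s"
  shows "local_discrepancy s N p x \<le> 1"
proof -
  have x: "0 \<le> x i" "x i \<le> 1" if "i < s" for i
    using assms that by (auto simp: unit_cube_def PiE_iff)
  have "0 \<le> (\<Prod>i<s. x i)" "(\<Prod>i<s. x i) \<le> 1"
    using x by (auto intro!: prod_nonneg prod_le_1)
  moreover have "card {j \<in> {..<N}. p j \<in> anchored_box s x} \<le> N"
    using card_mono[of "{..<N}" "{j \<in> {..<N}. p j \<in> anchored_box s x}"] by auto
  \<comment> \<open>This includes \<open>N = 0\<close>, where the quotient is 0.\<close>
  then have "real (card {j \<in> {..<N}. p j \<in> anchored_box s x}) / real N \<le> 1"
    by (simp add: divide_le_eq)
  moreover have "0 \<le> real (card {j \<in> {..<N}. p j \<in> anchored_box s x}) / real N"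
    by simp
  ultimately show ?thesis
    unfolding local_discrepancy_def by linarith
qed

lemma bdd_above_local_discrepancy: "bdd_above (local_discrepancy s N p ` unit_cube s)"
  using local_discrepancy_le_1 by (intro bdd_aboveI2[where M = 1])

lemma unit_cube_nonempty: "unit_cube s \<noteq> {}"
  by (auto simp: unit_cube_def PiE_eq_empty_iff)

lemma local_discrepancy_le_star:
  "x \<in> unit_cube s \<Longrightarrow> local_discrepancy s N p x \<le> star_discrepancy s N p"
  unfolding star_discrepancy_eq by (rule cSUP_upper[OF _ bdd_above_local_discrepancy])

lemma star_discrepancy_nonneg: "0 \<le> star_discrepancy s N p"
proof -
  obtain x where x: "x \<in> unit_cube s"
    using unit_cube_nonempty by auto
  have "0 \<le> local_discrepancy s N p x"
    by (simp add: local_discrepancy_def)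
  then show ?thesis
    using local_discrepancy_le_star[OF x] by (rule order_trans)
qed

lemma star_discrepancy_le_1: "star_discrepancy s N p \<le> 1"
  unfolding star_discrepancy_eq
  by (intro cSUP_least unit_cube_nonempty local_discrepancy_le_1)

definition rational_cube :: "nat \<Rightarrow> (nat \<Rightarrow> real) set" where
  "rational_cube s = PiE {..<s} (\<lambda>_. \<rat> \<inter> {0..1})"

lemma countable_rational_cube: "countable (rational_cube s)"
  unfolding rational_cube_def by (intro countable_PiE) (auto intro: countable_rat)

lemma rational_cube_subset: "rational_cube s \<subseteq> unit_cube s"
  unfolding rational_cube_def unit_cube_def by (intro PiE_mono) auto

text \<open>Counts in closed boxes are right-continuous in the corner, so the supremum over the uncountable cube
reduces to a countable one.\<close>

lemma local_discrepancy_rational_approx: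
  assumes x: "x \<in> unit_cube s" and c: "c < local_discrepancy s N p x"
  shows "\<exists>y \<in> rational_cube s. c < local_discrepancy s N p y"
proof -
  have x01: "0 \<le> x i" "x i \<le> 1" if "i < s" for i
    using x that by (auto simp: unit_cube_def PiE_iff)
  have "\<exists>q. q \<in> \<rat> \<and> 0 \<le> q \<and> q \<le> 1 \<and> x i \<le> q \<and> q \<le> x i + 1 / real (Suc k)" if "i < s" for i k
  proof (cases "x i = 1")
    \<comment> \<open>There is no room above 1 inside the cube, but 1 is itself rational.\<close>
    case True
    then show ?thesis by (intro exI[of _ 1]) auto
  next
    case False
    then have "x i < min 1 (x i + 1 / real (Suc k))"
      using x01[OF that] by simp
    then obtain q where "q \<in> \<rat>" "x i < q" "q < min 1 (x i + 1 / real (Suc k))"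
      using Rats_dense_in_real by blast
    then show ?thesis
      using x01[OF that] by (intro exI[of _ q]) auto
  qed
  then obtain q where q: "\<And>i k. i < s \<Longrightarrow> q i k \<in> \<rat> \<and> 0 \<le> q i k \<and> q i k \<le> 1 \<and> x i \<le> q i k
      \<and> q i k \<le> x i + 1 / real (Suc k)"
    by metis
  define y where "y k = (\<lambda>i\<in>{..<s}. q i k)" for k
  have y: "y k \<in> rational_cube s" for k
    using q by (auto simp: y_def rational_cube_def)
  have lim: "(\<lambda>k. y k i) \<longlonglongrightarrow> x i" if "i < s" for i
  proof (rule tendsto_sandwich[OF _ _ tendsto_const[of "x i"]])
    show "(\<lambda>k. x i + 1 / real (Suc k)) \<longlonglongrightarrow> x i"
      using tendsto_add[OF tendsto_const LIMSEQ_inverse_real_of_nat, of "x i"]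
      by (simp add: inverse_eq_divide)
  qed (use q that in \<open>auto simp: y_def\<close>)
  have "\<forall>\<^sub>F k in sequentially. p j \<in> anchored_box s (y k) \<longleftrightarrow> p j \<in> anchored_box s x" for j
  proof -
    \<comment> \<open>The corners \<open>y k\<close> approach \<open>x\<close> from above: a
      coordinate at most \<open>x i\<close> always stays inside, and one beyond \<open>x i\<close>
      is eventually excluded.\<close>
    have "\<forall>\<^sub>F k in sequentially. \<forall>i\<in>{..<s}. p j i \<le> y k i \<longleftrightarrow> p j i \<le> x i"
    proof (intro eventually_ball_finite ballI)
      fix i assume i: "i \<in> {..<s}"
      then have ge: "x i \<le> y k i" for k
        using q by (auto simp: y_def)
      show "\<forall>\<^sub>F k in sequentially. p j i \<le> y k i \<longleftrightarrow> p j i \<le> x i"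
      proof (cases "p j i \<le> x i")
        case True
        then have "p j i \<le> y k i" for k
          using ge by (rule order_trans)
        with True show ?thesis by simp
      next
        case False
        then have "\<forall>\<^sub>F k in sequentially. y k i < p j i"
          using i lim by (intro order_tendstoD(2)) auto
        then show ?thesis
          using False by (auto elim!: eventually_mono)
      qed
    qed simp
    then show ?thesis
      by (rule eventually_mono) (auto simp: anchored_box_def PiE_iff)
  qed
  then have "\<forall>\<^sub>F k in sequentially. \<forall>j\<in>{..<N}. p j \<in> anchored_box s (y k) \<longleftrightarrow> p j \<in> anchored_box s x"
    by (intro eventually_ball_finite) auto
  then have ev: "\<forall>\<^sub>F k in sequentially.
      \<bar>real (card {j \<in> {..<N}. p j \<in> anchored_box s x}) / real N - (\<Prod>i<s. y k i)\<bar>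
        = local_discrepancy s N p (y k)"
  proof (rule eventually_mono)
    fix k assume "\<forall>j\<in>{..<N}. p j \<in> anchored_box s (y k) \<longleftrightarrow> p j \<in> anchored_box s x"
    then have "{j \<in> {..<N}. p j \<in> anchored_box s (y k)} = {j \<in> {..<N}. p j \<in> anchored_box s x}"
      by blast
    then show "\<bar>real (card {j \<in> {..<N}. p j \<in> anchored_box s x}) / real N - (\<Prod>i<s. y k i)\<bar>
        = local_discrepancy s N p (y k)"
      by (simp add: local_discrepancy_def)
  qed
  \<comment> \<open>With the count frozen at its value for \<open>x\<close>, only the volume varies,
    and it is continuous.\<close>
  have "(\<lambda>k. \<bar>real (card {j \<in> {..<N}. p j \<in> anchored_box s x}) / real N - (\<Prod>i<s. y k i)\<bar>)
      \<longlonglongrightarrow> local_discrepancy s N p x"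
    unfolding local_discrepancy_def using lim by (intro tendsto_intros) auto
  then have "(\<lambda>k. local_discrepancy s N p (y k)) \<longlonglongrightarrow> local_discrepancy s N p x"
    using ev by (rule Lim_transform_eventually)
  then have "\<forall>\<^sub>F k in sequentially. c < local_discrepancy s N p (y k)"
    using c by (rule order_tendstoD(1))
  then obtain k where "c < local_discrepancy s N p (y k)"
    by (auto simp: eventually_sequentially)
  then show ?thesis
    using y by blast
qed

lemma borel_measurable_local_discrepancy:
  "(\<lambda>\<omega>. local_discrepancy s N \<omega> x) \<in> borel_measurable (random_points N s)"
proof -
  have "real (card {j \<in> {..<N}. \<omega> j \<in> anchored_box s x})
      = (\<Sum>j<N. indicator (anchored_box s x) (\<omega> j))" for \<omega> :: "nat \<Rightarrow> nat \<Rightarrow> real"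
    by (simp add: indicator_def sum.If_cases Int_def)
  moreover have "(\<lambda>\<omega>. indicator (anchored_box s x) (\<omega> j) :: real)
      \<in> borel_measurable (random_points N s)" if "j < N" for j
    unfolding random_points_def using that
    by (intro measurable_compose[OF measurable_component_singleton]
        borel_measurable_indicator anchored_box_sets) auto
  ultimately show ?thesis
    unfolding local_discrepancy_def by (auto intro!: borel_measurable_abs borel_measurable_diff
        borel_measurable_divide borel_measurable_sum)
qed

lemma borel_measurable_star_discrepancy:
  "star_discrepancy s N \<in> borel_measurable (random_points N s)"
  unfolding borel_measurable_iff_greater
proof
  fix c :: real
  have "c < star_discrepancy s N \<omega> \<longleftrightarrow> (\<exists>y \<in> rational_cube s. c < local_discrepancy s N \<omega> y)" for \<omega>
    unfolding star_discrepancy_eq less_cSUP_iff[OF unit_cube_nonempty bdd_above_local_discrepancy]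
    using local_discrepancy_rational_approx rational_cube_subset by blast
  then have "{\<omega> \<in> space (random_points N s). c < star_discrepancy s N \<omega>}
      = (\<Union>y \<in> rational_cube s. {\<omega> \<in> space (random_points N s). c < local_discrepancy s N \<omega> y})"
    by auto
  also have "\<dots> \<in> sets (random_points N s)"
    using borel_measurable_local_discrepancy
    by (intro sets.countable_UN' countable_rational_cube) (auto simp: borel_measurable_iff_greater)
  finally show "{\<omega> \<in> space (random_points N s). c < star_discrepancy s N \<omega>} \<in> sets (random_points N s)" .
qed

lemma sets_star_discrepancy_less:
  "{\<omega> \<in> space (random_points N s). star_discrepancy s N \<omega> < t} \<in> sets (random_points N s)"
  using borel_measurable_star_discrepancy by (simp add: borel_measurable_iff_less)

lemma integrable_star_discrepancy: "integrable (random_points N s) (star_discrepancy s N)"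
proof -
  interpret prob_space "random_points N s" by (rule prob_space_random_points)
  show ?thesis
    using borel_measurable_star_discrepancy star_discrepancy_nonneg star_discrepancy_le_1
    by (intro integrable_const_bound[where B = 1]) auto
qed

subsection \<open>The law of the slab incidences\<close>

text \<open>\<^term>\<open>C i\<close> is the set of points lying in the slab of coordinate \<^term>\<open>i\<close>. The columns \<^term>\<open>C i\<close> of the
incidence matrix are independent, although the random points are given by its rows.\<close>

definition column_event :: "real \<Rightarrow> nat \<Rightarrow> nat \<Rightarrow> (nat \<Rightarrow> nat set) \<Rightarrow> (nat \<Rightarrow> nat \<Rightarrow> real) set" where
  "column_event \<delta> N s C =
     PiE {..<N} (\<lambda>j. PiE {..<s} (\<lambda>i. if j \<in> C i then {1 - \<delta><..1} else {0..1 - \<delta>}))"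

lemma sets_column_event: "column_event \<delta> N s C \<in> sets (random_points N s)"
  unfolding column_event_def random_points_def
  by (intro sets_PiM_I_finite sets_uniform_cube_PiE) auto

text \<open>All entries of the incidence matrix are independent with probability
  \<open>\<delta>\<close>, so the product over rows can be regrouped into a product over
  columns.\<close>

lemma measure_column_event:
  assumes \<delta>: "0 \<le> \<delta>" "\<delta> \<le> 1" and C: "C \<in> PiE {..<s} (\<lambda>_. Pow {..<N})"
  shows "measure (random_points N s) (column_event \<delta> N s C)
    = (\<Prod>i<s. subset_weight \<delta> {..<N} (C i))"
proof -
  have slab: "measure (uniform_measure lborel {0..1::real}) (if b then {1 - \<delta><..1} else {0..1 - \<delta>})
      = (if b then \<delta> else 1 - \<delta>)" for b
  proof -
    have "{0..1} \<inter> {1 - \<delta><..1} = {1 - \<delta><..1}" "{0..1} \<inter> {0..1 - \<delta>} = {0..1 - \<delta>}"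
      using \<delta> by auto
    then show ?thesis
      using \<delta> by auto
  qed
  have row: "measure (uniform_cube s) (PiE {..<s} (\<lambda>i. if j \<in> C i then {1 - \<delta><..1} else {0..1 - \<delta>}))
      = (\<Prod>i<s. if j \<in> C i then \<delta> else 1 - \<delta>)" for j
    unfolding uniform_cube_def slab[symmetric]
    by (intro measure_PiM_PiE prob_space_uniform_measure) auto
  have "measure (random_points N s) (column_event \<delta> N s C)
      = (\<Prod>j<N. \<Prod>i<s. if j \<in> C i then \<delta> else 1 - \<delta>)"
    unfolding random_points_def column_event_def row[symmetric]
    by (intro measure_PiM_PiE prob_space_uniform_cube sets_uniform_cube_PiE) auto
  also have "\<dots> = (\<Prod>i<s. subset_weight \<delta> {..<N} (C i))"
    using C by (subst prod.swap) (auto intro!: prod.cong simp: subset_weight_prod PiE_iff)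
  finally show ?thesis .
qed

text \<open>The points determine the pattern: \<open>j\<close> is in column \<open>i\<close> exactly
  when \<open>\<omega> j i\<close> exceeds \<open>1 - \<delta>\<close>.\<close>

lemma disjoint_column_events:
  assumes "C \<in> PiE {..<s} (\<lambda>_. Pow {..<N})" "D \<in> PiE {..<s} (\<lambda>_. Pow {..<N})" "C \<noteq> D"
  shows "column_event \<delta> N s C \<inter> column_event \<delta> N s D = {}"
proof (rule ccontr)
  assume "column_event \<delta> N s C \<inter> column_event \<delta> N s D \<noteq> {}"
  then obtain \<omega> where \<omega>: "\<omega> \<in> column_event \<delta> N s C" "\<omega> \<in> column_event \<delta> N s D"
    by blast
  have eq: "j \<in> E i \<longleftrightarrow> 1 - \<delta> < \<omega> j i" if "\<omega> \<in> column_event \<delta> N s E" "j < N" "i < s" for E j i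
  proof -
    have "\<omega> j i \<in> (if j \<in> E i then {1 - \<delta><..1} else {0..1 - \<delta>})"
      using that by (simp add: column_event_def PiE_iff)
    then show ?thesis by (auto split: if_splits)
  qed
  have "C i = D i" if i: "i < s" for i
  proof -
    have "C i \<subseteq> {..<N}" "D i \<subseteq> {..<N}"
      using assms i by (auto simp: PiE_iff)
    then show ?thesis
      using eq[OF \<omega>(1) _ i] eq[OF \<omega>(2) _ i] by blast
  qed
  then have "C = D"
    using assms by (intro PiE_ext) auto
  with assms show False by simp
qed

lemma star_discrepancy_column_event_ge:
  assumes \<delta>: "0 \<le> \<delta>" "\<delta> \<le> 1" and g: "0 \<le> g" and \<omega>: "\<omega> \<in> column_event \<delta> N s C"
  shows "g * (1 - \<delta>) ^ s * real (card (cuts \<delta> g {..<N} C s)) / real N \<le> star_discrepancy s N \<omega>"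
proof (cases "N = 0")
  case True
  then show ?thesis by (simp add: star_discrepancy_nonneg)
next
  case False
  define K where "K = cuts \<delta> g {..<N} C s"
  \<comment> \<open>The greedy box. It contains every survivor and has volume
    \<open>(1 - \<delta>) ^ card K\<close>, so the surplus in \<open>card_survivors_ge\<close> is a
    discrepancy.\<close>
  define x where "x = (\<lambda>i\<in>{..<s}. if i \<in> K then 1 - \<delta> else 1)"
  have x: "x \<in> unit_cube s"
    using \<delta> by (auto simp: x_def unit_cube_def)
  have "{..<s} \<inter> K = K"
    unfolding K_def using cuts_subset by blast
  then have vol: "(\<Prod>i<s. x i) = (1 - \<delta>) ^ card K"
    by (simp add: x_def prod.If_cases)
  have "survivors \<delta> g {..<N} C s \<subseteq> {j \<in> {..<N}. \<omega> j \<in> anchored_box s x}"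
  proof
    fix j assume "j \<in> survivors \<delta> g {..<N} C s"
    then have j: "j < N" "\<And>i. i \<in> K \<Longrightarrow> j \<notin> C i"
      by (auto simp: survivors_iff K_def)
    have \<omega>j: "\<omega> j \<in> PiE {..<s} (\<lambda>i. if j \<in> C i then {1 - \<delta><..1} else {0..1 - \<delta>})"
      using \<omega> j by (auto simp: column_event_def PiE_iff)
    have "\<omega> j i \<in> {0..x i}" if "i < s" for i
    proof -
      have "\<omega> j i \<in> (if j \<in> C i then {1 - \<delta><..1} else {0..1 - \<delta>})"
        using \<omega>j that by (simp add: PiE_iff)
      then show ?thesis
        using that j(2)[of i] \<delta> by (auto simp: x_def split: if_splits)
    qed
    then show "j \<in> {j \<in> {..<N}. \<omega> j \<in> anchored_box s x}"
      using \<omega>j j by (auto simp: anchored_box_def PiE_iff)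
  qed
  then have "card (survivors \<delta> g {..<N} C s) \<le> card {j \<in> {..<N}. \<omega> j \<in> anchored_box s x}"
    by (intro card_mono) auto
  moreover have "real N * (1 - \<delta>) ^ card K + g * (1 - \<delta>) ^ s * real (card K)
      \<le> real (card (survivors \<delta> g {..<N} C s))"
    using card_survivors_ge[of "{..<N}" \<delta> g C s] \<delta> g by (simp add: K_def)
  ultimately have "real N * (1 - \<delta>) ^ card K + g * (1 - \<delta>) ^ s * real (card K)
      \<le> real (card {j \<in> {..<N}. \<omega> j \<in> anchored_box s x})"
    by linarith
  then have "g * (1 - \<delta>) ^ s * real (card K) / real N
      \<le> real (card {j \<in> {..<N}. \<omega> j \<in> anchored_box s x}) / real N - (1 - \<delta>) ^ card K"
    using False by (simp add: field_simps)
  also have "\<dots> \<le> local_discrepancy s N \<omega> x"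
    unfolding local_discrepancy_def vol by simp
  also have "\<dots> \<le> star_discrepancy s N \<omega>"
    using x by (rule local_discrepancy_le_star)
  finally show ?thesis
    by (simp add: K_def)
qed

subsection \<open>The lower bound\<close>

lemma prob_star_discrepancy_less:
  fixes N s :: nat and \<delta> g p :: real
  assumes \<delta>: "0 \<le> \<delta>" "\<delta> \<le> 1" and g: "0 \<le> g" and p: "p \<le> 1"
    and light: "\<And>S. S \<subseteq> {..<N} \<Longrightarrow> real N * (1 - \<delta>) ^ s \<le> real (card S) \<Longrightarrow>
        p \<le> subset_mean \<delta> {..<N} (\<lambda>C. of_bool (light \<delta> g S C))"
  shows "measure (random_points N s)
      {\<omega> \<in> space (random_points N s). star_discrepancy s N \<omega> < g * (1 - \<delta>) ^ s * (p / 4 * real s) / real N}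
    \<le> exp (- (p / 4) * real s)"
proof -
  interpret prob_space "random_points N s" by (rule prob_space_random_points)
  define A where "A = PiE {..<s} (\<lambda>_. Pow {..<N})"
  define F where "F = {C \<in> A. real (card (cuts \<delta> g {..<N} C s)) < p / 4 * real s}"
  define t where "t = g * (1 - \<delta>) ^ s * (p / 4 * real s) / real N"
  define L where "L = {\<omega> \<in> space (random_points N s). star_discrepancy s N \<omega> < t}"
  \<comment> \<open>The good event of many cuts. Bounding its probability from below and showing it
    disjoint from \<open>L\<close> avoids treating points outside the unit cube, which lie in the
    sample space but in no column event.\<close>
  define G where "G = (\<Union>C\<in>A - F. column_event \<delta> N s C)"
  have finA: "finite A"
    unfolding A_def by (intro finite_PiE) auto
  have "prob G = (\<Sum>C\<in>A - F. prob (column_event \<delta> N s C))"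
    unfolding G_def using finA disjoint_column_events
    by (intro finite_measure_finite_Union)
       (auto simp: sets_column_event disjoint_family_on_def A_def)
  also have "\<dots> = (\<Sum>C\<in>A - F. \<Prod>i<s. subset_weight \<delta> {..<N} (C i))"
    using \<delta> by (intro sum.cong measure_column_event) (auto simp: A_def)
  also have "\<dots> = 1 - (\<Sum>C\<in>F. \<Prod>i<s. subset_weight \<delta> {..<N} (C i))"
    using finA sum_column_weights[of "{..<N}" \<delta> s]
    by (subst sum_diff) (auto simp: F_def A_def)
  also have "\<dots> \<ge> 1 - exp (- (p / 4) * real s)"
    using few_cuts_weight_le[of "{..<N}" \<delta> g p s] \<delta> g p light by (simp add: F_def A_def)
  finally have G: "1 - exp (- (p / 4) * real s) \<le> prob G" .
  have "G \<inter> L = {}"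
  proof -
    have "t \<le> star_discrepancy s N \<omega>" if "C \<in> A - F" "\<omega> \<in> column_event \<delta> N s C" for C \<omega>
    proof -
      have "p / 4 * real s \<le> real (card (cuts \<delta> g {..<N} C s))"
        using that by (simp add: F_def not_less)
      then have "t \<le> g * (1 - \<delta>) ^ s * real (card (cuts \<delta> g {..<N} C s)) / real N"
        unfolding t_def using g \<delta> by (intro divide_right_mono mult_left_mono) auto
      also have "\<dots> \<le> star_discrepancy s N \<omega>"
        using \<delta> g that(2) by (rule star_discrepancy_column_event_ge)
      finally show ?thesis .
    qed
    then show ?thesis
      by (force simp: G_def L_def)
  qed
  moreover have "G \<in> events"
    unfolding G_def using finA by (intro sets.finite_UN sets_column_event) auto
  moreover have "L \<in> events"
    unfolding L_def by (rule sets_star_discrepancy_less)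
  ultimately have "prob G + prob L \<le> 1"
    using finite_measure_Union[of G L] prob_le_1[of "G \<union> L"] by simp
  then show ?thesis
    using G unfolding L_def t_def by simp
qed

lemma prob_star_discrepancy_less_sqrt:
  assumes s: "0 < s" "s \<le> N"
  shows "measure (random_points N s)
      {\<omega> \<in> space (random_points N s). star_discrepancy s N \<omega> < 1/144000 * sqrt (real s / real N)}
    \<le> exp (- (1/2400) * real s)"
proof -
  interpret prob_space "random_points N s" by (rule prob_space_random_points)
  define \<delta> g where "\<delta> = 1 / (2 * real s)" and "g = sqrt (real N / real s) / 30"
  have \<delta>: "0 \<le> \<delta>" "\<delta> \<le> 1/2" and g: "0 \<le> g"
    using s by (auto simp: \<delta>_def g_def field_simps)
  \<comment> \<open>By Bernoulli, even cutting all \<open>s\<close> coordinates leaves volume at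
    least 1/2.\<close>
  have "1 + real s * (- \<delta>) \<le> (1 + (- \<delta>)) ^ s"
    using \<delta> by (intro Bernoulli_inequality) auto
  then have pw: "1/2 \<le> (1 - \<delta>) ^ s"
    using s by (simp add: \<delta>_def)
  have light: "1/600 \<le> subset_mean \<delta> {..<N} (\<lambda>C. of_bool (light \<delta> g S C))"
    if S: "S \<subseteq> {..<N}" "real N * (1 - \<delta>) ^ s \<le> real (card S)" for S
  proof (rule subset_mean_light_ge)
    have "real N * (1/2) \<le> real N * (1 - \<delta>) ^ s"
      using pw by (intro mult_left_mono) auto
    with S have "real N / 2 \<le> real (card S)" by linarith
    moreover have "\<delta> * (1/2) \<le> \<delta> * (1 - \<delta>)"
      using \<delta> by (intro mult_left_mono) auto
    ultimately have "\<delta> * (1/2) * (real N / 2) \<le> \<delta> * (1 - \<delta>) * real (card S)"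
      using \<delta> by (intro mult_mono) auto
    also have "\<delta> * (1/2) * (real N / 2) = real N / real s / 8"
      by (simp add: \<delta>_def)
    finally have V: "real N / real s / 8 \<le> \<delta> * (1 - \<delta>) * real (card S)" .
    \<comment> \<open>The assumption \<open>s \<le> N\<close> keeps the variance of the slab count
      at least 1/8.\<close>
    have "1 \<le> real N / real s"
      using s by simp
    then have "1/8 \<le> real N / real s / 8"
      by simp
    then show "1/8 \<le> \<delta> * (1 - \<delta>) * real (card S)"
      using V by (rule order_trans)
    \<comment> \<open>Weakening 1/8 to 1/9 gives a rational square root; this is the source of the
      30 in \<open>g\<close>.\<close>
    have "sqrt (real N / real s) / 3 = sqrt (real N / real s / 9)"
      using real_sqrt_divide[of "real N / real s" 9] by simp
    also have "\<dots> \<le> sqrt (\<delta> * (1 - \<delta>) * real (card S))"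
    proof (rule real_sqrt_le_mono)
      have "real N / real s / 9 \<le> real N / real s / 8"
        by (intro divide_left_mono) auto
      then show "real N / real s / 9 \<le> \<delta> * (1 - \<delta>) * real (card S)"
        using V by (rule order_trans)
    qed
    finally show "g \<le> sqrt (\<delta> * (1 - \<delta>) * real (card S)) / 10"
      by (simp add: g_def)
  qed (use S \<delta> in auto)
  have "sqrt (real N / real s) * real s / real N = sqrt (real s / real N)"
    using s by (simp add: real_sqrt_divide field_simps)
  \<comment> \<open>144000 = 30 * 2 * 2400: from \<open>g\<close>, from the volume bound 1/2, and
    from p/4 with p = 1/600.\<close>
  then have "1/144000 * sqrt (real s / real N) = g * (1/2) * (1/600 / 4 * real s) / real N"
    by (simp add: g_def)
  also have "\<dots> \<le> g * (1 - \<delta>) ^ s * (1/600 / 4 * real s) / real N"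
    using pw g by (intro divide_right_mono mult_right_mono mult_left_mono) auto
  finally have thr: "1/144000 * sqrt (real s / real N)
      \<le> g * (1 - \<delta>) ^ s * (1/600 / 4 * real s) / real N" .
  have "prob {\<omega> \<in> space (random_points N s). star_discrepancy s N \<omega> < 1/144000 * sqrt (real s / real N)}
      \<le> prob {\<omega> \<in> space (random_points N s).
          star_discrepancy s N \<omega> < g * (1 - \<delta>) ^ s * (1/600 / 4 * real s) / real N}"
    using thr by (intro finite_measure_mono sets_star_discrepancy_less) (blast intro: less_le_trans)
  also have "\<dots> \<le> exp (- (1/600 / 4) * real s)"
    using \<delta> g light by (intro prob_star_discrepancy_less) auto
  finally show ?thesis by simp
qed

theorem theorem1:
  shows "\<exists>K::real. K > 0 \<and> (\<exists>k::real. k > 0 \<and>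
    (\<forall>N s :: nat. s \<le> N \<longrightarrow>
       K * sqrt (real s / real N)
         \<le> (\<integral>\<omega>. star_discrepancy s N \<omega> \<partial>random_points N s)
     \<and> measure (random_points N s)
         {\<omega> \<in> space (random_points N s). star_discrepancy s N \<omega> < K * sqrt (real s / real N)}
         \<le> exp (- k * real s)))"
proof -
  \<comment> \<open>The tail bound holds at the level \<open>c\<close>; the factor
    \<open>1 - exp (- k)\<close> is the price for the expectation.\<close>
  define c k K :: real where "c = 1/144000" and "k = 1/2400" and "K = c * (1 - exp (- k))"
  have pos: "0 < c" "0 < k" "0 < K" "K \<le> c"
    by (auto simp: c_def k_def K_def)
  have "K * sqrt (real s / real N) \<le> (\<integral>\<omega>. star_discrepancy s N \<omega> \<partial>random_points N s)
     \<and> measure (random_points N s)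
         {\<omega> \<in> space (random_points N s). star_discrepancy s N \<omega> < K * sqrt (real s / real N)}
         \<le> exp (- k * real s)" if "s \<le> N" for N s
  proof -
    interpret prob_space "random_points N s" by (rule prob_space_random_points)
    show ?thesis
    proof (cases "s = 0")
      \<comment> \<open>Both thresholds are 0 and the probability bound is 1. This also covers
        \<open>N = 0\<close>.\<close>
      case True
      then show ?thesis
        using star_discrepancy_nonneg prob_le_1 by (simp add: integral_nonneg_AE)
    next
      case False
      define r where "r = sqrt (real s / real N)"
      define L where "L = (\<lambda>t. {\<omega> \<in> space (random_points N s). star_discrepancy s N \<omega> < t})"
      have r: "0 < r" using False that by (simp add: r_def)
      have L: "L t \<in> events" for t
        unfolding L_def by (rule sets_star_discrepancy_less)
      have bound: "prob (L (c * r)) \<le> exp (- k * real s)"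
        unfolding L_def r_def c_def k_def using False that
        by (intro prob_star_discrepancy_less_sqrt) auto
      \<comment> \<open>Since \<open>s\<close> is at least 1, the failure probability is bounded
        away from 1 uniformly.\<close>
      have "k * 1 \<le> k * real s"
        using False pos by (intro mult_left_mono) auto
      then have "exp (- k * real s) \<le> exp (- k)"
        by simp
      with bound have "prob (L (c * r)) \<le> exp (- k)"
        by (rule order_trans)
      then have "c * r * (1 - exp (- k)) \<le> c * r * (1 - prob (L (c * r)))"
        using pos r by (intro mult_left_mono) auto
      also have "\<dots> = c * r * prob (space (random_points N s) - L (c * r))"
        by (simp add: prob_compl[OF L])
      also have "\<dots> \<le> c * r * prob {\<omega> \<in> space (random_points N s). c * r \<le> star_discrepancy s N \<omega>}"
        using pos r borel_measurable_star_discrepancy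
        by (intro mult_left_mono finite_measure_mono)
           (auto simp: L_def borel_measurable_iff_ge)
      also have "\<dots> \<le> (\<integral>\<omega>. star_discrepancy s N \<omega> \<partial>random_points N s)"
        using integral_Markov_inequality_measure[OF integrable_star_discrepancy, of "{}" N s "c * r"]
          star_discrepancy_nonneg pos r by (simp add: field_simps)
      finally have E: "K * r \<le> (\<integral>\<omega>. star_discrepancy s N \<omega> \<partial>random_points N s)"
        by (simp add: K_def mult_ac)
      have "K * r \<le> c * r"
        using pos r by (intro mult_right_mono) auto
      then have "prob (L (K * r)) \<le> prob (L (c * r))"
        by (intro finite_measure_mono L) (auto simp: L_def)
      with bound E show ?thesis
        by (simp add: L_def r_def)
    qed
  qed
  with pos show ?thesis by blast
qed

end
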